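(* Let $M\ge 1$, let $X\subseteq\mathbb{R}$ be an interval, let $x_1<\dots<x_M$ be points of the interior of $X$, let $x_0$ be a point of the interior of $X$, and let $H$ be a real separable Hilbert space. (1) Assume that $\varphi\in\mathcal{K}^{2}(X;H)$ and let $m_0=\sum_{i=1}^{M}a_i\delta_{x_i}$ with $a_i>0$ for all $i\in\{1,\dots,M\}$. Assume moreover that $\Gamma_{x}$ has full rank. Then the Non-Degenerate Source Condition (NDSC) holds for $m_0$ if and only if $$\forall t\in X,\quad D_V(t)>0 .$$ (2) Similarly, let $\varphi\in\mathcal{K}^{2M}(X;H)$ and assume that $F_{2M-1}$ has full rank. Then the point $x_0$ is $(2M-1)$ Non Degenerate if and only if $$\forall t\in X,\quad D_W(t)>0 .$$
   Context: $C_0(X)$ is the space of continuous functions $\eta:X\to\mathbb{R}$ such that for every $\varepsilon>0$ there is a compact $K\subset X$ with $|\eta|\le\varepsilon$ on $X\setminus K$. For $k\in\mathbb{N}$, $\mathcal{K}^k(X;H)$ is the set of $\varphi\in C^k(X;H)$ such that $x\mapsto\langle p,\varphi(x)\rangle_H$ belongs to $C_0(X)$ for all $p\in H$ and $\sup_{x\in X}\|\varphi^{(i)}(x)\|_H<\infty$ for $0\le i\le k$. $\Gamma_x:\mathbb{R}^{2M}\to H$ is $\Gamma_x b=\sum_{i=1}^M\left(b_{2i-1}\varphi(x_i)+b_{2i}\varphi'(x_i)\right)$ and $F_{2M-1}:\mathbb{R}^{2M}\to H$ is $F_{2M-1}b=\sum_{k=0}^{2M-1}b_{k+1}\varphi^{(k)}(x_0)$;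 full rank means injective. For $p\in H$, $(\Phi^*p)(x)=\langle\varphi(x),p\rangle_H$. If $\Gamma_x$ has full rank, $p_V$ is the element of minimal norm of $\{p\in H:\ (\Phi^*p)(x_i)=1,\ (\Phi^*p)'(x_i)=0,\ 1\le i\le M\}$ and $\eta_V=\Phi^*p_V$. The measure $m_0$ satisfies the NDSC if $\eta_V(x)<1$ for all $x\in X\setminus\{x_1,\dots,x_M\}$ and $\eta_V''(x_i)<0$ for all $1\le i\le M$. If $F_{2M-1}$ has full rank, $p_W$ is the element of minimal norm of $\{p\in H:\ (\Phi^*p)(x_0)=1,\ (\Phi^*p)^{(k)}(x_0)=0,\ 1\le k\le 2M-1\}$ and $\eta_W=\Phi^*p_W$. The point $x_0$ is $(2M-1)$ Non Degenerate if $\varphi\in\mathcal{K}^{2M}(X;H)$, $F_{2M-1}$ has full rank, $\eta_W^{(2M)}(x_0)<0$, and $\eta_W(x)<1$ for all $x\in X\setminus\{x_0\}$. Let $C(x,y)=\langle\varphi(x),\varphi(y)\rangle_H$. Put $(u_0,u_1,\dots,u_{2M})=(1,C(\cdot,x_1),\partial_2C(\cdot,x_1),\dots,C(\cdot,x_M),\partial_2C(\cdot,x_M))$ and, for $t\in X\setminus\{x_i\}_{i=1}^M$, $$D_V(t)=\frac{2}{\prod_{i=1}^M(t-x_i)^2}\begin{vmatrix} u_0(t)&\cdots& u_{2M}(t) \\ u_0(x_1)&\cdots& u_{2M}(x_1) \\ u_0'(x_1)&\cdots& u_{2M}'(x_1) \\ \vdots&&\vdots \\ u_0(x_M)&\cdots&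 u_{2M}(x_M) \\ u_0'(x_M)&\cdots& u_{2M}'(x_M)\end{vmatrix};$$ $D_V(x_i)$ is defined by continuous extension. Put $(v_0,v_1,\dots,v_{2M})=(1,C(\cdot,x_0),\partial_2C(\cdot,x_0),\dots,(\partial_2)^{2M-1}C(\cdot,x_0))$ and, for $t\in X\setminus\{x_0\}$, $$D_W(t)=\frac{(2M)!}{(t-x_0)^{2M}}\begin{vmatrix} v_0(t)&\cdots& v_{2M}(t) \\ v_0(x_0)&\cdots& v_{2M}(x_0) \\ v_0'(x_0)&\cdots& v_{2M}'(x_0) \\ \vdots&&\vdots \\ v_0^{(2M-1)}(x_0)&\cdots& v_{2M}^{(2M-1)}(x_0)\end{vmatrix};$$ $D_W(x_0)$ is defined by continuous extension. *)

theory Defs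
  imports "HOL-Analysis.Analysis" "Jordan_Normal_Form.Determinant"
begin

(* Derivatives are taken within X, hence one-sided at end points belonging to X. *)
primrec nderiv :: "real set \<Rightarrow> nat \<Rightarrow> (real \<Rightarrow> 'a::real_normed_vector) \<Rightarrow> real \<Rightarrow> 'a" where
  "nderiv X 0 f = f"
| "nderiv X (Suc k) f = (\<lambda>x. vector_derivative (nderiv X k f) (at x within X))"

definition C_k :: "nat \<Rightarrow> real set \<Rightarrow> (real \<Rightarrow> 'a::real_normed_vector) set" where
  "C_k k X = {f. (\<forall>i<k. \<forall>x\<in>X. nderiv X i f differentiable (at x within X)) \<and>
                 (\<forall>i\<le>k. continuous_on X (nderiv X i f))}"

definition C_zero :: "real set \<Rightarrow> (real \<Rightarrow> real) set" where
  "C_zero X = {\<eta>. continuous_on X \<eta> \<and>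
     (\<forall>\<epsilon>>0. \<exists>K. compact K \<and> K \<subseteq> X \<and> (\<forall>x\<in>X - K. \<bar>\<eta> x\<bar> \<le> \<epsilon>))}"

definition kernel_class :: "nat \<Rightarrow> real set \<Rightarrow> (real \<Rightarrow> 'h::real_inner) set" where
  "kernel_class k X = {\<phi> \<in> C_k k X. (\<forall>p. (\<lambda>x. inner p (\<phi> x)) \<in> C_zero X) \<and>
     (\<forall>i\<le>k. bdd_above ((\<lambda>x. norm (nderiv X i \<phi> x)) ` X))}"

(* Vectors of R^(2M) have entries 0, ..., 2M - 1, whereas the points x 1, ..., x M are
   numbered from 1: the coefficients of \<phi>(x i) and \<phi>'(x i) are entries 2i - 2 and 2i - 1. *)
definition Gamma_op :: "real set \<Rightarrow> (real \<Rightarrow> 'h::real_inner) \<Rightarrow> nat \<Rightarrow> (nat \<Rightarrow> real) \<Rightarrow> real vec \<Rightarrow> 'h" where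
  "Gamma_op X \<phi> M x b = (\<Sum>i=1..M. vec_index b (2*i - 2) *\<^sub>R \<phi> (x i)
                                    + vec_index b (2*i - 1) *\<^sub>R nderiv X 1 \<phi> (x i))"

definition F_op :: "real set \<Rightarrow> (real \<Rightarrow> 'h::real_inner) \<Rightarrow> nat \<Rightarrow> real \<Rightarrow> real vec \<Rightarrow> 'h" where
  "F_op X \<phi> M x\<^sub>0 b = (\<Sum>k<2*M. vec_index b k *\<^sub>R nderiv X k \<phi> x\<^sub>0)"

definition full_rank :: "nat \<Rightarrow> (real vec \<Rightarrow> 'h::real_inner) \<Rightarrow> bool" where
  "full_rank n T \<longleftrightarrow> inj_on T (carrier_vec n)"

definition Phi_adj :: "(real \<Rightarrow> 'h::real_inner) \<Rightarrow> 'h \<Rightarrow> real \<Rightarrow> real" where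
  "Phi_adj \<phi> p = (\<lambda>x. inner (\<phi> x) p)"

definition min_norm_element :: "'h::real_normed_vector set \<Rightarrow> 'h" where
  "min_norm_element S = (THE p. p \<in> S \<and> (\<forall>q\<in>S. norm p \<le> norm q))"

definition p_V :: "real set \<Rightarrow> (real \<Rightarrow> 'h::real_inner) \<Rightarrow> nat \<Rightarrow> (nat \<Rightarrow> real) \<Rightarrow> 'h" where
  "p_V X \<phi> M x = min_norm_element
     {p. \<forall>i\<in>{1..M}. Phi_adj \<phi> p (x i) = 1 \<and> nderiv X 1 (Phi_adj \<phi> p) (x i) = 0}"

definition eta_V :: "real set \<Rightarrow> (real \<Rightarrow> 'h::real_inner) \<Rightarrow> nat \<Rightarrow> (nat \<Rightarrow> real) \<Rightarrow> real \<Rightarrow> real" where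
  "eta_V X \<phi> M x = Phi_adj \<phi> (p_V X \<phi> M x)"

definition p_W :: "real set \<Rightarrow> (real \<Rightarrow> 'h::real_inner) \<Rightarrow> nat \<Rightarrow> real \<Rightarrow> 'h" where
  "p_W X \<phi> M x\<^sub>0 = min_norm_element
     {p. Phi_adj \<phi> p x\<^sub>0 = 1 \<and> (\<forall>k\<in>{1..2*M - 1}. nderiv X k (Phi_adj \<phi> p) x\<^sub>0 = 0)}"

definition eta_W :: "real set \<Rightarrow> (real \<Rightarrow> 'h::real_inner) \<Rightarrow> nat \<Rightarrow> real \<Rightarrow> real \<Rightarrow> real" where
  "eta_W X \<phi> M x\<^sub>0 = Phi_adj \<phi> (p_W X \<phi> M x\<^sub>0)"

(* The sum of the Dirac masses a i at x i for 1 \<le> i \<le> M, as a Borel measure on X: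
   the push-forward under x of the weights a on {1..M}. *)
definition spike_measure :: "real set \<Rightarrow> nat \<Rightarrow> (nat \<Rightarrow> real) \<Rightarrow> (nat \<Rightarrow> real) \<Rightarrow> real measure" where
  "spike_measure X M a x =
     distr (point_measure {1..M} (\<lambda>i. ennreal (a i))) (restrict_space borel X) x"

(* M, a and x (on {1..M}) are determined by the measure m. As eta_V is meaningful only if
   Gamma_op X \<phi> M x has full rank, NDSC is to be used under that assumption. *)
definition NDSC :: "real set \<Rightarrow> (real \<Rightarrow> 'h::real_inner) \<Rightarrow> real measure \<Rightarrow> bool" where
  "NDSC X \<phi> m \<longleftrightarrow> (\<exists>M a x. strict_mono_on {1..M} x \<and> x ` {1..M} \<subseteq> interior X \<and>
     (\<forall>i\<in>{1..M}. 0 < a i) \<and> m = spike_measure X M a x \<and>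
     (\<forall>t\<in>X - x ` {1..M}. eta_V X \<phi> M x t < 1) \<and>
     (\<forall>i\<in>{1..M}. nderiv X 2 (eta_V X \<phi> M x) (x i) < 0))"

(* "x0 is (2M - 1) Non Degenerate" *)
definition non_degenerate :: "real set \<Rightarrow> (real \<Rightarrow> 'h::real_inner) \<Rightarrow> nat \<Rightarrow> real \<Rightarrow> bool" where
  "non_degenerate X \<phi> M x\<^sub>0 \<longleftrightarrow> \<phi> \<in> kernel_class (2*M) X \<and> full_rank (2*M) (F_op X \<phi> M x\<^sub>0) \<and>
     nderiv X (2*M) (eta_W X \<phi> M x\<^sub>0) x\<^sub>0 < 0 \<and> (\<forall>t\<in>X - {x\<^sub>0}. eta_W X \<phi> M x\<^sub>0 t < 1)"

definition Corr :: "(real \<Rightarrow> 'h::real_inner) \<Rightarrow> real \<Rightarrow> real \<Rightarrow> real" where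
  "Corr \<phi> s t = inner (\<phi> s) (\<phi> t)"

definition d2_Corr :: "real set \<Rightarrow> (real \<Rightarrow> 'h::real_inner) \<Rightarrow> nat \<Rightarrow> real \<Rightarrow> real \<Rightarrow> real" where
  "d2_Corr X \<phi> k s t = nderiv X k (\<lambda>t'. Corr \<phi> s t') t"

(* Index j = 2i - 1 gives C(., x i) and j = 2i gives the derivative of C in its second
   argument at x i; the rows r = 2i - 1 and r = 2i of det_V are numbered in the same way. *)
definition u_fun :: "real set \<Rightarrow> (real \<Rightarrow> 'h::real_inner) \<Rightarrow> (nat \<Rightarrow> real) \<Rightarrow> nat \<Rightarrow> real \<Rightarrow> real" where
  "u_fun X \<phi> x j t =
     (if j = 0 then 1 else d2_Corr X \<phi> (if odd j then 0 else 1) t (x ((j + 1) div 2)))"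

definition det_V :: "real set \<Rightarrow> (real \<Rightarrow> 'h::real_inner) \<Rightarrow> nat \<Rightarrow> (nat \<Rightarrow> real) \<Rightarrow> real \<Rightarrow> real" where
  "det_V X \<phi> M x t = Determinant.det (Matrix.mat (2*M + 1) (2*M + 1) (\<lambda>(r, j).
     if r = 0 then u_fun X \<phi> x j t
     else nderiv X (if odd r then 0 else 1) (u_fun X \<phi> x j) (x ((r + 1) div 2))))"

definition D_V :: "real set \<Rightarrow> (real \<Rightarrow> 'h::real_inner) \<Rightarrow> nat \<Rightarrow> (nat \<Rightarrow> real) \<Rightarrow> real \<Rightarrow> real" where
  "D_V X \<phi> M x t = (let Q = (\<lambda>s. 2 / (\<Prod>i=1..M. (s - x i)^2) * det_V X \<phi> M x s) in
     if t \<in> x ` {1..M} then Lim (at t within X) Q else Q t)"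

definition v_fun :: "real set \<Rightarrow> (real \<Rightarrow> 'h::real_inner) \<Rightarrow> real \<Rightarrow> nat \<Rightarrow> real \<Rightarrow> real" where
  "v_fun X \<phi> x\<^sub>0 j t = (if j = 0 then 1 else d2_Corr X \<phi> (j - 1) t x\<^sub>0)"

definition det_W :: "real set \<Rightarrow> (real \<Rightarrow> 'h::real_inner) \<Rightarrow> nat \<Rightarrow> real \<Rightarrow> real \<Rightarrow> real" where
  "det_W X \<phi> M x\<^sub>0 t = Determinant.det (Matrix.mat (2*M + 1) (2*M + 1) (\<lambda>(r, j).
     if r = 0 then v_fun X \<phi> x\<^sub>0 j t else nderiv X (r - 1) (v_fun X \<phi> x\<^sub>0 j) x\<^sub>0))"

definition D_W :: "real set \<Rightarrow> (real \<Rightarrow> 'h::real_inner) \<Rightarrow> nat \<Rightarrow> real \<Rightarrow> real \<Rightarrow> real" where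
  "D_W X \<phi> M x\<^sub>0 t = (let Q = (\<lambda>s. fact (2*M) / (s - x\<^sub>0)^(2*M) * det_W X \<phi> M x\<^sub>0 s) in
     if t = x\<^sub>0 then Lim (at t within X) Q else Q t)"

end

theory Submission
  imports Defs
begin

text \<open>The minimal norm element is \<open>p = (\<Sum>j. b j e j)\<close> with \<open>e j\<close> the vectors representing the
  constraints and \<open>b\<close> the solution of the linear system given by their Gram matrix \<open>G\<close>.  Subtracting
  from the first column of the bordered determinant the combination of the other columns with
  coefficients \<open>b\<close> leaves \<open>1 - \<eta> t\<close> as only entry of that column, so the determinant is
  \<open>(1 - \<eta> t) * det G\<close>, where \<open>det G > 0\<close>.  By Taylor's formula the normalised quotient tends
  to a positive multiple of minus the highest derivative of \<open>\<eta>\<close> at the interpolation points.\<close>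

section \<open>Gram determinants and interpolation\<close>

text \<open>The column operation is right multiplication by the unitriangular matrix
  \<open>T\<close>, which has determinant 1. It clears column 0 below its top entry, so Laplace
  expansion along that column leaves a single cofactor.\<close>

lemma det_bordered:
  fixes A :: "nat \<times> nat \<Rightarrow> 'a::comm_ring_1"
  assumes "\<And>r. r < n \<Longrightarrow> A (Suc r, 0) = (\<Sum>j<n. b j * A (Suc r, Suc j))"
  shows "Determinant.det (Matrix.mat (Suc n) (Suc n) A) =
    (A (0, 0) - (\<Sum>j<n. b j * A (0, Suc j))) *
      Determinant.det (Matrix.mat n n (\<lambda>(r, j). A (Suc r, Suc j)))"
proof -
  define B where "B = Matrix.mat (Suc n) (Suc n) A"
  define T where "T = Matrix.mat (Suc n) (Suc n)
    (\<lambda>(r, j). if r = j then 1 else if j = 0 then - b (r - 1) else (0 :: 'a))"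
  have B: "B \<in> carrier_mat (Suc n) (Suc n)" and T: "T \<in> carrier_mat (Suc n) (Suc n)"
    by (auto simp: B_def T_def)
  have "Determinant.det T = prod_list (diag_mat T)"
    by (rule det_lower_triangular[OF _ T]) (auto simp: T_def)
  also have "\<dots> = 1"
    by (auto simp: prod_list_diag_prod T_def intro!: prod.neutral)
  finally have detT: "Determinant.det T = 1" .
  \<comment> \<open>Columns \<open>Suc j\<close> of \<open>T\<close> are unit vectors, so only
    column 0 of \<open>B\<close> is changed.\<close>
  have BT: "(B * T) $$ (r, j) = (\<Sum>k<Suc n. A (r, k) * T $$ (k, j))"
    if "r < Suc n" "j < Suc n" for r j
    using that B T
    by (auto simp: scalar_prod_def B_def T_def atLeast0LessThan intro!: sum.cong)
  have col0: "(B * T) $$ (r, 0) = A (r, 0) - (\<Sum>j<n. b j * A (r, Suc j))" if "r < Suc n" for r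
    unfolding BT[OF that zero_less_Suc] sum.lessThan_Suc_shift
    by (simp add: T_def sum_negf mult.commute)
  have colS: "(B * T) $$ (r, Suc j) = A (r, Suc j)" if "r < Suc n" "j < n" for r j
  proof -
    have "(B * T) $$ (r, Suc j) = (\<Sum>k<Suc n. if k = Suc j then A (r, k) else 0)"
      unfolding BT[OF that(1) Suc_mono[OF that(2)]]
      using that by (intro sum.cong) (auto simp: T_def)
    also have "\<dots> = A (r, Suc j)"
      using that by (subst sum.delta) auto
    finally show ?thesis .
  qed
  have "Determinant.det B = Determinant.det (B * T)"
    using det_mult[OF B T] detT by simp
  also have "\<dots> = (\<Sum>r<Suc n. (B * T) $$ (r, 0) * cofactor (B * T) r 0)"
    by (rule laplace_expansion_column[of _ "Suc n"]) (use B T in auto)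
  also have "\<dots> = (B * T) $$ (0, 0) * cofactor (B * T) 0 0"
    unfolding sum.lessThan_Suc_shift using col0 assms by simp
  also have "cofactor (B * T) 0 0 =
      Determinant.det (Matrix.mat n n (\<lambda>(r, j). A (Suc r, Suc j)))"
  proof -
    have "mat_delete (B * T) 0 0 = Matrix.mat n n (\<lambda>(r, j). A (Suc r, Suc j))"
      using B T colS by (intro eq_matI) (auto simp: mat_delete_def)
    then show ?thesis by (simp add: cofactor_def)
  qed
  finally show ?thesis
    using col0[of 0] by (simp add: B_def)
qed

definition gram_mat :: "nat \<Rightarrow> (nat \<Rightarrow> 'h::real_inner) \<Rightarrow> real mat" where
  "gram_mat n e = Matrix.mat n n (\<lambda>(r, j). inner (e r) (e j))"

definition independent_family :: "nat \<Rightarrow> (nat \<Rightarrow> 'h::real_vector) \<Rightarrow> bool" where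
  "independent_family n e \<longleftrightarrow> (\<forall>b. (\<Sum>j<n. b j *\<^sub>R e j) = 0 \<longrightarrow> (\<forall>j<n. b j = 0))"

text \<open>Cramer's rule: \<open>b\<close> is the adjugate applied to \<open>c\<close>, divided by
  the determinant.\<close>

lemma gram_mat_solve:
  assumes "Determinant.det (gram_mat n e) \<noteq> 0"
  obtains b where "\<And>r. r < n \<Longrightarrow> inner (e r) (\<Sum>j<n. b j *\<^sub>R e j) = c r"
proof -
  let ?G = "gram_mat n e"
  define b where "b = (\<lambda>j. (\<Sum>k<n. adj_mat ?G $$ (j, k) * c k) / Determinant.det ?G)"
  have G: "?G \<in> carrier_mat n n" by (simp add: gram_mat_def)
  note adj = adj_mat[OF G]
  have "inner (e r) (\<Sum>j<n. b j *\<^sub>R e j) = c r" if r: "r < n" for r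
  proof -
    \<comment> \<open>The entries of the identity \<open>G * adj G = det G * 1\<close>.\<close>
    have delta: "(\<Sum>j<n. inner (e r) (e j) * adj_mat ?G $$ (j, k)) =
        (if r = k then Determinant.det ?G else 0)" if "k < n" for k
    proof -
      have "(?G * adj_mat ?G) $$ (r, k) = (\<Sum>j<n. inner (e r) (e j) * adj_mat ?G $$ (j, k))"
        using r that G adj(1)
        by (auto simp: scalar_prod_def gram_mat_def atLeast0LessThan intro!: sum.cong)
      then show ?thesis using r that by (cases "r = k") (simp_all add: adj(2))
    qed
    have "inner (e r) (\<Sum>j<n. b j *\<^sub>R e j) =
        (\<Sum>j<n. \<Sum>k<n. inner (e r) (e j) * adj_mat ?G $$ (j, k) * c k) / Determinant.det ?G"
      by (simp add: inner_sum_right b_def sum_distrib_left sum_divide_distrib ac_simps)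
    also have "\<dots> = (\<Sum>k<n. (\<Sum>j<n. inner (e r) (e j) * adj_mat ?G $$ (j, k)) * c k) /
        Determinant.det ?G"
      by (subst sum.swap) (simp add: sum_distrib_right)
    also have "(\<Sum>k<n. (\<Sum>j<n. inner (e r) (e j) * adj_mat ?G $$ (j, k)) * c k) =
        (\<Sum>k<n. if r = k then Determinant.det ?G * c k else 0)"
      by (rule sum.cong) (auto simp: delta)
    also have "\<dots> = Determinant.det ?G * c r"
      using r by simp
    finally show ?thesis using assms by simp
  qed
  then show ?thesis by (rule that)
qed

text \<open>Peeling off \<open>e 0\<close> multiplies the determinant by the squared distance from
  \<open>e 0\<close> to the span of the remaining vectors, which is positive by independence. The
  induction hypothesis also makes the system for the orthogonal projection \<open>p\<close> of
  \<open>e 0\<close> solvable.\<close>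

lemma gram_mat_det_pos:
  assumes "independent_family n e"
  shows "Determinant.det (gram_mat n e) > 0"
  using assms
proof (induction n arbitrary: e)
  case 0
  show ?case by (simp add: gram_mat_def)
next
  case (Suc n)
  define e' where "e' = (\<lambda>j. e (Suc j))"
  have indep: "b 0 = 0 \<and> (\<forall>j<n. b (Suc j) = 0)"
    if "b 0 *\<^sub>R e 0 + (\<Sum>j<n. b (Suc j) *\<^sub>R e' j) = 0" for b
  proof -
    have "(\<Sum>j<Suc n. b j *\<^sub>R e j) = 0"
      unfolding sum.lessThan_Suc_shift using that by (simp add: e'_def)
    then show ?thesis using Suc.prems unfolding independent_family_def by blast
  qed
  have "independent_family n e'"
    unfolding independent_family_def
    using indep[of "case_nat 0 b" for b] by simp
  then have pos: "Determinant.det (gram_mat n e') > 0" by (rule Suc.IH)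
  then obtain b where b: "\<And>r. r < n \<Longrightarrow> inner (e' r) (\<Sum>j<n. b j *\<^sub>R e' j) = inner (e' r) (e 0)"
    using gram_mat_solve[of n e' "\<lambda>r. inner (e' r) (e 0)"] by auto
  define p where "p = (\<Sum>j<n. b j *\<^sub>R e' j)"
  have "Determinant.det (gram_mat (Suc n) e) =
      (inner (e 0) (e 0) - (\<Sum>j<n. b j * inner (e 0) (e' j))) * Determinant.det (gram_mat n e')"
    unfolding gram_mat_def
    using b by (subst det_bordered[where b = b]) (auto simp: inner_sum_right e'_def)
  also have "inner (e 0) (e 0) - (\<Sum>j<n. b j * inner (e 0) (e' j)) = inner (e 0) (e 0 - p)"
    by (simp add: p_def inner_diff_right inner_sum_right)
  \<comment> \<open>The residual \<open>e 0 - p\<close> is orthogonal to each \<open>e' r\<close>,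
    hence to \<open>p\<close>.\<close>
  also have "\<dots> = inner (e 0 - p) (e 0 - p)"
  proof -
    have "inner (e' r) (e 0 - p) = 0" if "r < n" for r
      using b[OF that] by (simp add: p_def inner_diff_right)
    then have "inner (\<Sum>j<n. b j *\<^sub>R e' j) (e 0 - p) = 0"
      by (simp add: inner_sum_left)
    then have "inner p (e 0 - p) = 0" by (simp add: p_def)
    then show ?thesis by (simp add: inner_diff_left)
  qed
  finally have "Determinant.det (gram_mat (Suc n) e) =
      inner (e 0 - p) (e 0 - p) * Determinant.det (gram_mat n e')" .
  \<comment> \<open>Otherwise there would be a vanishing combination with coefficient 1 at
    \<open>e 0\<close>.\<close>
  moreover have "e 0 - p \<noteq> 0"
    using indep[of "case_nat 1 (\<lambda>j. - b j)"] by (auto simp: p_def sum_negf)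
  ultimately show ?case using pos by (simp add: inner_gt_zero_iff)
qed

text \<open>A solution \<open>p\<close> in the span of the constraint vectors is orthogonal to
  \<open>q - p\<close> for every other solution \<open>q\<close>. Pythagoras then gives both
  minimality and uniqueness, so the \<open>THE\<close> in \<open>min_norm_element\<close> is well
  defined.\<close>

lemma min_norm_element_eqI:
  assumes "\<And>j. j < n \<Longrightarrow> inner (e j) (\<Sum>j<n. b j *\<^sub>R e j) = c j"
  shows "min_norm_element {p. \<forall>j<n. inner (e j) p = c j} = (\<Sum>j<n. b j *\<^sub>R e j)"
proof -
  define p where "p = (\<Sum>j<n. b j *\<^sub>R e j)"
  define S where "S = {p. \<forall>j<n. inner (e j) p = c j}"
  have pS: "p \<in> S" using assms by (simp add: S_def p_def)
  have pyth: "(norm q)\<^sup>2 = (norm p)\<^sup>2 + (norm (q - p))\<^sup>2" if "q \<in> S" for q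
  proof -
    have "inner (e j) (q - p) = 0" if "j < n" for j
      using \<open>q \<in> S\<close> pS that by (simp add: S_def inner_diff_right)
    then have "inner (\<Sum>j<n. b j *\<^sub>R e j) (q - p) = 0" by (simp add: inner_sum_left)
    then have "inner p (q - p) = 0" by (simp add: p_def)
    then show ?thesis
      unfolding power2_norm_eq_inner by (simp add: inner_diff_left inner_diff_right inner_commute)
  qed
  have "min_norm_element S = p"
    unfolding min_norm_element_def
  proof (rule the_equality)
    have "norm p \<le> norm q" if "q \<in> S" for q
      by (rule power2_le_imp_le) (simp_all add: pyth[OF that])
    then show "p \<in> S \<and> (\<forall>q\<in>S. norm p \<le> norm q)" using pS by blast
  next
    fix q assume q: "q \<in> S \<and> (\<forall>q'\<in>S. norm q \<le> norm q')"
    then have "(norm q)\<^sup>2 \<le> (norm p)\<^sup>2" using pS by (simp add: power_mono)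
    then have "(norm (q - p))\<^sup>2 \<le> 0" using pyth[of q] q by simp
    then show "q = p" by simp
  qed
  then show ?thesis by (simp add: S_def p_def)
qed

lemma inner_min_norm_element:
  assumes "independent_family n e" "j < n"
  shows "inner (e j) (min_norm_element {p. \<forall>j<n. inner (e j) p = c j}) = c j"
proof -
  obtain b where b: "\<And>r. r < n \<Longrightarrow> inner (e r) (\<Sum>j<n. b j *\<^sub>R e j) = c r"
    using gram_mat_solve[of n e c] gram_mat_det_pos[OF assms(1)] by auto
  have "min_norm_element {p. \<forall>j<n. inner (e j) p = c j} = (\<Sum>j<n. b j *\<^sub>R e j)"
    by (rule min_norm_element_eqI) (rule b)
  then show ?thesis using b[OF assms(2)] by simp
qed

text \<open>Common shape of \<open>det_V\<close> and \<open>det_W\<close>: row 0 is evaluation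
  against \<open>f\<close>, later taken to be \<open>\<phi> t\<close>, and column 0 carries the
  constraint values \<open>c\<close>. The coefficients that clear column 0 are exactly those of the
  minimal norm element.\<close>

lemma det_bordered_gram_mat:
  fixes e :: "nat \<Rightarrow> 'h::real_inner"
  assumes "independent_family n e"
    and A: "\<And>r. r < n \<Longrightarrow> A (Suc r, 0) = c r"
      "\<And>r j. r < n \<Longrightarrow> j < n \<Longrightarrow> A (Suc r, Suc j) = inner (e r) (e j)"
      "\<And>j. j < n \<Longrightarrow> A (0, Suc j) = inner f (e j)"
  shows "Determinant.det (Matrix.mat (Suc n) (Suc n) A) =
    (A (0, 0) - inner f (min_norm_element {p. \<forall>j<n. inner (e j) p = c j})) *
      Determinant.det (gram_mat n e)"
proof -
  obtain b where b: "\<And>r. r < n \<Longrightarrow> inner (e r) (\<Sum>j<n. b j *\<^sub>R e j) = c r"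
    using gram_mat_solve[of n e c] gram_mat_det_pos[OF assms(1)] by auto
  have "min_norm_element {p. \<forall>j<n. inner (e j) p = c j} = (\<Sum>j<n. b j *\<^sub>R e j)"
    by (rule min_norm_element_eqI) (rule b)
  moreover have "Matrix.mat n n (\<lambda>(r, j). A (Suc r, Suc j)) = gram_mat n e"
    by (intro eq_matI) (auto simp: gram_mat_def A)
  moreover have "A (Suc r, 0) = (\<Sum>j<n. b j * A (Suc r, Suc j))" if "r < n" for r
    using b[OF that] that by (simp add: A inner_sum_right)
  ultimately show ?thesis
    by (subst det_bordered[where b = b]) (simp_all add: A inner_sum_right)
qed

lemma full_rank_imp_independent_family:
  assumes "full_rank n T" "\<And>b. T b = (\<Sum>j<n. vec_index b j *\<^sub>R e j)"
  shows "independent_family n e"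
  unfolding independent_family_def
proof (intro allI impI)
  fix b j assume "(\<Sum>j<n. b j *\<^sub>R e j) = 0" "j < n"
  \<comment> \<open>Both sides are zero, so injectivity applies to this pair.\<close>
  then have "T (Matrix.vec n b) = T (0\<^sub>v n)" by (simp add: assms(2))
  then have "Matrix.vec n b = 0\<^sub>v n"
    using assms(1) by (auto simp: full_rank_def dest: inj_onD)
  from arg_cong[OF this, of "\<lambda>v. vec_index v j"] show "b j = 0" using \<open>j < n\<close> by simp
qed

section \<open>Iterated derivatives within an interval\<close>

text \<open>A connected set with more than one point has no isolated points. This makes derivatives
  within \<open>X\<close>, and limits within \<open>X\<close>, unique at every point of
  \<open>X\<close>, end points included.\<close>

lemma is_interval_at_within_ne_bot:
  fixes X :: "real set"
  assumes "is_interval X" "interior X \<noteq> {}" "t \<in> X"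
  shows "at t within X \<noteq> bot"
proof -
  have "X \<noteq> {s}" for s using assms(2) by auto
  then show ?thesis
    using connected_imp_perfect[of X t] assms is_interval_connected_1[of X]
    by (simp add: trivial_limit_within)
qed

lemma C_k_has_vector_derivative:
  assumes "f \<in> C_k m X" "k < m" "t \<in> X"
  shows "(nderiv X k f has_vector_derivative nderiv X (Suc k) f t) (at t within X)"
  using assms by (simp add: C_k_def vector_derivative_works)

text \<open>Used with \<open>L\<close> the inner product against a fixed vector, in either argument.
  The point \<open>t\<close> stays arbitrary in the induction, because the next derivative depends
  on the previous one on all of \<open>X\<close>.\<close>

lemma nderiv_bounded_linear:
  assumes "bounded_linear L" "f \<in> C_k m X" "\<And>t. t \<in> X \<Longrightarrow> at t within X \<noteq> bot"
    "k \<le> m" "t \<in> X"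
  shows "nderiv X k (\<lambda>s. L (f s)) t = L (nderiv X k f t)"
  using assms(4,5)
proof (induction k arbitrary: t)
  case (Suc k)
  have "((\<lambda>s. L (nderiv X k f s)) has_vector_derivative L (nderiv X (Suc k) f t)) (at t within X)"
    using Suc.prems assms
    by (intro bounded_linear.has_vector_derivative[OF assms(1)] C_k_has_vector_derivative) auto
  then have "(nderiv X k (\<lambda>s. L (f s)) has_vector_derivative L (nderiv X (Suc k) f t))
      (at t within X)"
    by (rule has_vector_derivative_transform[rotated 2]) (use Suc in auto)
  then show ?case
    using vector_derivative_within[OF assms(3)] Suc.prems by simp
qed simp

lemma C_k_bounded_linear:
  assumes "bounded_linear L" "f \<in> C_k m X" "\<And>t. t \<in> X \<Longrightarrow> at t within X \<noteq> bot"
  shows "(\<lambda>s. L (f s)) \<in> C_k m X"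
proof -
  note eq = nderiv_bounded_linear[OF assms]
  have "nderiv X i (\<lambda>s. L (f s)) differentiable (at t within X)" if "i < m" "t \<in> X" for i t
  proof -
    have "((\<lambda>s. L (nderiv X i f s)) has_vector_derivative L (nderiv X (Suc i) f t)) (at t within X)"
      using that
      by (intro bounded_linear.has_vector_derivative[OF assms(1)]
          C_k_has_vector_derivative[OF assms(2)]) auto
    then have "(nderiv X i (\<lambda>s. L (f s)) has_vector_derivative L (nderiv X (Suc i) f t))
        (at t within X)"
      by (rule has_vector_derivative_transform[rotated 2]) (use that eq in auto)
    then show ?thesis
      by (auto simp: has_vector_derivative_def differentiable_def)
  qed
  moreover have "continuous_on X (nderiv X i (\<lambda>s. L (f s)))" if "i \<le> m" for i
  proof -
    have "continuous_on X (\<lambda>t. L (nderiv X i f t))"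
      using that assms(2) by (intro bounded_linear.continuous_on[OF assms(1)]) (auto simp: C_k_def)
    then show ?thesis
      by (rule continuous_on_eq) (use that eq in auto)
  qed
  ultimately show ?thesis by (simp add: C_k_def)
qed

text \<open>Yields column 0 of the two determinants, whose generating function is the constant
  1.\<close>

lemma nderiv_const:
  assumes "\<And>t. t \<in> X \<Longrightarrow> at t within X \<noteq> bot" "t \<in> X"
  shows "nderiv X k (\<lambda>_. c) t = (if k = 0 then c else 0)"
  using assms(2)
proof (induction k arbitrary: t)
  case (Suc k)
  have "(nderiv X k (\<lambda>_. c) has_vector_derivative 0) (at t within X)"
    by (rule has_vector_derivative_transform[OF _ _ has_vector_derivative_const])
      (use Suc in auto)
  then show ?case
    using vector_derivative_within[OF assms(1)] Suc.prems by simp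
qed simp

text \<open>With the intermediate derivatives zero, the Lagrange form of Taylor's formula turns the
  quotient into the derivative of order \<open>m\<close> at some \<open>s\<close> closer to
  \<open>t\<^sub>0\<close> than \<open>t\<close>, divided by \<open>fact m\<close>. Continuity of
  that derivative gives the limit.\<close>

lemma taylor_quotient_tendsto:
  fixes f :: "real \<Rightarrow> real"
  assumes f: "f \<in> C_k m X" and "m \<ge> 1" and t0: "t\<^sub>0 \<in> interior X"
    and zero: "\<And>k. k \<in> {1..<m} \<Longrightarrow> nderiv X k f t\<^sub>0 = 0"
  shows "((\<lambda>t. (f t - f t\<^sub>0) / (t - t\<^sub>0) ^ m) \<longlongrightarrow> nderiv X m f t\<^sub>0 / fact m) (at t\<^sub>0 within X)"
proof -
  obtain d where d: "d > 0" "cball t\<^sub>0 d \<subseteq> interior X"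
    using t0 open_interior[of X] unfolding open_contains_cball by blast
  \<comment> \<open>In the interior of \<open>X\<close>, derivatives within \<open>X\<close> are
    ordinary two-sided derivatives, as \<open>Taylor\<close> demands.\<close>
  have deriv: "DERIV (nderiv X k f) t :> nderiv X (Suc k) f t"
    if "k < m" "t \<in> cball t\<^sub>0 d" for k t
  proof -
    have "t \<in> interior X" using that(2) d(2) by blast
    moreover from this have "t \<in> X" using interior_subset by blast
    ultimately show ?thesis
      using C_k_has_vector_derivative[OF f that(1)]
      unfolding has_real_derivative_iff_has_vector_derivative by (metis at_within_interior)
  qed
  have mean: "\<exists>s. \<bar>s - t\<^sub>0\<bar> < \<bar>t - t\<^sub>0\<bar> \<and>
      (f t - f t\<^sub>0) / (t - t\<^sub>0) ^ m = nderiv X m f s / fact m"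
    if t: "t \<in> cball t\<^sub>0 d" "t \<noteq> t\<^sub>0" for t
  proof -
    have "\<exists>s. (if t < t\<^sub>0 then t < s \<and> s < t\<^sub>0 else t\<^sub>0 < s \<and> s < t) \<and>
        f t = (\<Sum>k<m. (nderiv X k f t\<^sub>0 / fact k) * (t - t\<^sub>0) ^ k) +
          (nderiv X m f s / fact m) * (t - t\<^sub>0) ^ m"
    proof (rule Taylor[of m "\<lambda>k. nderiv X k f" f "t\<^sub>0 - d" "t\<^sub>0 + d"])
      show "\<forall>k s. k < m \<and> t\<^sub>0 - d \<le> s \<and> s \<le> t\<^sub>0 + d \<longrightarrow>
          DERIV (nderiv X k f) s :> nderiv X (Suc k) f s"
        using deriv unfolding cball_eq_atLeastAtMost atLeastAtMost_iff by blast
    qed (use t \<open>m \<ge> 1\<close> d(1) in \<open>simp_all add: cball_eq_atLeastAtMost\<close>)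
    then obtain s where s: "if t < t\<^sub>0 then t < s \<and> s < t\<^sub>0 else t\<^sub>0 < s \<and> s < t"
      and eq: "f t = (\<Sum>k<m. (nderiv X k f t\<^sub>0 / fact k) * (t - t\<^sub>0) ^ k) +
          (nderiv X m f s / fact m) * (t - t\<^sub>0) ^ m" by blast
    have "(\<Sum>k<m. (nderiv X k f t\<^sub>0 / fact k) * (t - t\<^sub>0) ^ k) =
        (\<Sum>k<m. if k = 0 then f t\<^sub>0 else 0)"
      by (rule sum.cong) (auto simp: zero)
    also have "\<dots> = f t\<^sub>0" using \<open>m \<ge> 1\<close> by simp
    finally have "f t - f t\<^sub>0 = (nderiv X m f s / fact m) * (t - t\<^sub>0) ^ m" using eq by simp
    moreover have "\<bar>s - t\<^sub>0\<bar> < \<bar>t - t\<^sub>0\<bar>" using s by (auto split: if_splits)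
    ultimately show ?thesis using t(2) by (intro exI[of _ s]) simp
  qed
  have "isCont (nderiv X m f) t\<^sub>0"
    using f t0 continuous_on_interior[of X "nderiv X m f" t\<^sub>0] by (simp add: C_k_def)
  then have cont: "isCont (\<lambda>s. nderiv X m f s / fact m) t\<^sub>0"
    by (intro continuous_intros) auto
  have "((\<lambda>t. (f t - f t\<^sub>0) / (t - t\<^sub>0) ^ m) \<longlongrightarrow> nderiv X m f t\<^sub>0 / fact m) (at t\<^sub>0)"
    unfolding LIM_eq
  proof (intro allI impI)
    fix r :: real assume "r > 0"
    then obtain e where e: "e > 0" "\<And>s. \<bar>s - t\<^sub>0\<bar> < e \<Longrightarrow>
        \<bar>nderiv X m f s / fact m - nderiv X m f t\<^sub>0 / fact m\<bar> < r"
      using cont unfolding continuous_at_eps_delta dist_real_def by meson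
    \<comment> \<open>The bound \<open>d\<close> keeps \<open>t\<close> where the mean value form
      holds; the bound \<open>e\<close> passes from \<open>t\<close> to the closer point
      \<open>s\<close>.\<close>
    have "norm ((f t - f t\<^sub>0) / (t - t\<^sub>0) ^ m - nderiv X m f t\<^sub>0 / fact m) < r"
      if t: "t \<noteq> t\<^sub>0" "norm (t - t\<^sub>0) < min d e" for t
    proof -
      have "t \<in> cball t\<^sub>0 d" using t(2) by (simp add: dist_real_def abs_minus_commute)
      then obtain s where "\<bar>s - t\<^sub>0\<bar> < \<bar>t - t\<^sub>0\<bar>"
        "(f t - f t\<^sub>0) / (t - t\<^sub>0) ^ m = nderiv X m f s / fact m"
        using mean[of t] t(1) by blast
      then show ?thesis using e(2)[of s] t by simp
    qed
    then show "\<exists>s>0. \<forall>x. x \<noteq> t\<^sub>0 \<and> norm (x - t\<^sub>0) < s \<longrightarrow>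
        norm ((f x - f t\<^sub>0) / (x - t\<^sub>0) ^ m - nderiv X m f t\<^sub>0 / fact m) < r"
      using d(1) e(1) by (intro exI[of _ "min d e"]) auto
  qed
  then show ?thesis by (rule tendsto_within_subset) simp
qed

section \<open>Atoms of spike measures\<close>

lemma emeasure_spike_measure_singleton:
  assumes "x ` {1..M} \<subseteq> X" "t \<in> X"
  shows "emeasure (spike_measure X M a x) {t} = (\<Sum>i\<in>{i\<in>{1..M}. x i = t}. ennreal (a i))"
proof -
  have "{t} \<in> sets (restrict_space borel X)"
    using assms(2) by (auto simp: sets_restrict_space image_iff intro!: bexI[of _ "{t}"])
  moreover have "x \<in> measurable (point_measure {1..M} (\<lambda>i. ennreal (a i))) (restrict_space borel X)"
    using assms(1) by (auto simp: measurable_def space_point_measure sets_point_measure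
        space_restrict_space)
  ultimately have "emeasure (spike_measure X M a x) {t} =
      emeasure (point_measure {1..M} (\<lambda>i. ennreal (a i))) {i\<in>{1..M}. x i = t}"
    unfolding spike_measure_def
    by (subst emeasure_distr) (auto simp: space_point_measure intro!: arg_cong2[of _ _ _ _ emeasure])
  also have "\<dots> = (\<Sum>i\<in>{i\<in>{1..M}. x i = t}. ennreal (a i))"
    by (rule emeasure_point_measure_finite) auto
  finally show ?thesis .
qed

text \<open>Positive weights cannot sum to zero over a nonempty fibre, so the positions can be read
  off from the measure.\<close>

lemma spike_measure_atoms:
  assumes "x ` {1..M} \<subseteq> X" "\<forall>i\<in>{1..M}. 0 < a i"
  shows "x ` {1..M} = {t\<in>X. emeasure (spike_measure X M a x) {t} \<noteq> 0}"
proof -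
  have "emeasure (spike_measure X M a x) {t} \<noteq> 0 \<longleftrightarrow> t \<in> x ` {1..M}" if "t \<in> X" for t
    using emeasure_spike_measure_singleton[OF assms(1) that, of a] assms(2)
    by (auto simp: sum_eq_0_iff ennreal_eq_0_iff not_le)
  then show ?thesis using assms(1) by blast
qed

text \<open>Both functions list the same finite set as a sorted list without repetitions, and such a
  list is unique.\<close>

lemma strict_mono_on_image_eq:
  fixes x y :: "nat \<Rightarrow> 'a::linorder"
  assumes "strict_mono_on {1..M} x" "strict_mono_on {1..N} y" "x ` {1..M} = y ` {1..N}"
  shows "M = N \<and> (\<forall>i\<in>{1..M}. x i = y i)"
proof -
  have sorted: "sorted (map z [1..<Suc K])" and distinct: "distinct (map z [1..<Suc K])"
    if "strict_mono_on {1..K} z" for z :: "nat \<Rightarrow> 'a" and K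
  proof -
    show "sorted (map z [1..<Suc K])"
      unfolding sorted_wrt_map
      by (rule sorted_wrt_mono_rel[OF _ sorted_upt])
        (use strict_mono_on_leD[OF that] in \<open>auto simp del: upt_Suc\<close>)
    show "distinct (map z [1..<Suc K])"
      using strict_mono_on_imp_inj_on[OF that]
      by (auto simp: distinct_map atLeastLessThanSuc_atLeastAtMost simp del: upt_Suc)
  qed
  have eq: "map x [1..<Suc M] = map y [1..<Suc N]"
    by (rule sorted_distinct_set_unique)
      (use assms in \<open>simp_all only: sorted distinct set_map set_upt
        atLeastLessThanSuc_atLeastAtMost\<close>)
  then have MN: "M = N" using map_eq_imp_length_eq[OF eq] by (simp del: upt_Suc)
  moreover have "x i = y i" if "i \<in> {1..M}" for i
  proof -
    have "\<forall>i\<in>set [1..<Suc N]. x i = y i" using eq unfolding MN map_eq_conv .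
    then show ?thesis using that MN by (simp del: upt_Suc)
  qed
  ultimately show ?thesis by blast
qed

lemma spike_measure_eqD:
  assumes "strict_mono_on {1..M} x" "x ` {1..M} \<subseteq> X" "\<forall>i\<in>{1..M}. 0 < a i"
    "strict_mono_on {1..N} y" "y ` {1..N} \<subseteq> X" "\<forall>i\<in>{1..N}. 0 < b i"
    "spike_measure X M a x = spike_measure X N b y"
  shows "M = N \<and> (\<forall>i\<in>{1..M}. x i = y i)"
  using assms spike_measure_atoms[of x M X a] spike_measure_atoms[of y N X b]
  by (intro strict_mono_on_image_eq) auto

text \<open>The existential in \<open>NDSC\<close> might choose another representation of the
  measure, but any such choice has the same \<open>M\<close> and the same points on
  \<open>{1..M}\<close>.\<close>

lemma NDSC_spike_measure:
  assumes "strict_mono_on {1..M} x" "x ` {1..M} \<subseteq> interior X" "\<forall>i\<in>{1..M}. 0 < a i"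
  shows "NDSC X \<phi> (spike_measure X M a x) \<longleftrightarrow>
    (\<forall>t\<in>X - x ` {1..M}. eta_V X \<phi> M x t < 1) \<and>
    (\<forall>i\<in>{1..M}. nderiv X 2 (eta_V X \<phi> M x) (x i) < 0)"
proof
  assume "NDSC X \<phi> (spike_measure X M a x)"
  then obtain N b y where y: "strict_mono_on {1..N} y" "y ` {1..N} \<subseteq> interior X"
    "\<forall>i\<in>{1..N}. 0 < b i" "spike_measure X M a x = spike_measure X N b y"
    "\<forall>t\<in>X - y ` {1..N}. eta_V X \<phi> N y t < 1"
    "\<forall>i\<in>{1..N}. nderiv X 2 (eta_V X \<phi> N y) (y i) < 0"
    unfolding NDSC_def by blast
  have *: "M = N \<and> (\<forall>i\<in>{1..M}. x i = y i)"
    by (rule spike_measure_eqD[of M x X a N y b]) (use assms y interior_subset[of X] in auto)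
  \<comment> \<open>The functions \<open>x\<close> and \<open>y\<close> may differ outside
    \<open>{1..M}\<close>, but the constraints only see their values there.\<close>
  then have "{p. \<forall>i\<in>{1..M}. Phi_adj \<phi> p (x i) = 1 \<and> nderiv X 1 (Phi_adj \<phi> p) (x i) = 0} =
      {p. \<forall>i\<in>{1..N}. Phi_adj \<phi> p (y i) = 1 \<and> nderiv X 1 (Phi_adj \<phi> p) (y i) = 0}"
    by (metis (no_types, lifting))
  then have "eta_V X \<phi> M x = eta_V X \<phi> N y"
    unfolding eta_V_def p_V_def by (rule arg_cong)
  moreover have "x ` {1..M} = y ` {1..N}" using * by (auto intro: image_cong)
  ultimately show "(\<forall>t\<in>X - x ` {1..M}. eta_V X \<phi> M x t < 1) \<and>
    (\<forall>i\<in>{1..M}. nderiv X 2 (eta_V X \<phi> M x) (x i) < 0)"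
    using y(5,6) * by auto
next
  assume "(\<forall>t\<in>X - x ` {1..M}. eta_V X \<phi> M x t < 1) \<and>
    (\<forall>i\<in>{1..M}. nderiv X 2 (eta_V X \<phi> M x) (x i) < 0)"
  then show "NDSC X \<phi> (spike_measure X M a x)"
    unfolding NDSC_def using assms by blast
qed

section \<open>The two determinant criteria\<close>

lemma d2_Corr_eq:
  assumes "\<phi> \<in> C_k m X" "\<And>t. t \<in> X \<Longrightarrow> at t within X \<noteq> bot" "k \<le> m" "t \<in> X"
  shows "d2_Corr X \<phi> k s t = inner (\<phi> s) (nderiv X k \<phi> t)"
  unfolding d2_Corr_def Corr_def
  using nderiv_bounded_linear[OF bounded_linear_inner_right assms] .

lemma nderiv_inner_left:
  assumes "\<phi> \<in> C_k m X" "\<And>t. t \<in> X \<Longrightarrow> at t within X \<noteq> bot" "k \<le> m" "t \<in> X"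
  shows "nderiv X k (\<lambda>s. inner (\<phi> s) p) t = inner (nderiv X k \<phi> t) p"
  using nderiv_bounded_linear[OF bounded_linear_inner_left assms] .

text \<open>Pairs the zero-based indices as \<open>2*i - 2\<close> and \<open>2*i - 1\<close>, the
  numbering of coefficients in \<open>Gamma_op\<close>; the next lemma does the same for
  sums.\<close>

lemma all_lessThan_double_iff:
  fixes M :: nat
  shows "(\<forall>j<2*M. P j) \<longleftrightarrow> (\<forall>i\<in>{1..M}. P (2*i - 2) \<and> P (2*i - 1))"
proof
  assume R: "\<forall>i\<in>{1..M}. P (2*i - 2) \<and> P (2*i - 1)"
  show "\<forall>j<2*M. P j"
  proof (intro allI impI)
    fix j assume "j < 2*M"
    then have "j div 2 + 1 \<in> {1..M}" by auto
    with R have "P (2 * (j div 2))" "P (2 * (j div 2) + 1)" by force+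
    then show "P j" by (cases "even j") auto
  qed
qed auto

lemma sum_lessThan_double:
  fixes f :: "nat \<Rightarrow> 'a::comm_monoid_add"
  shows "(\<Sum>j<2*M. f j) = (\<Sum>i=1..M. f (2*i - 2) + f (2*i - 1))"
  by (induction M) (auto simp: ac_simps)

lemma D_V_pos_iff:
  assumes "is_interval X" and mono: "strict_mono_on {1..M} x"
    and xX: "x ` {1..M} \<subseteq> interior X" and "M \<ge> 1"
    and ck: "\<phi> \<in> C_k 2 X" and rank: "full_rank (2*M) (Gamma_op X \<phi> M x)"
  shows "(\<forall>t\<in>X. D_V X \<phi> M x t > 0) \<longleftrightarrow>
    (\<forall>t\<in>X - x ` {1..M}. eta_V X \<phi> M x t < 1) \<and>
    (\<forall>i\<in>{1..M}. nderiv X 2 (eta_V X \<phi> M x) (x i) < 0)"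
proof -
  have "1 \<in> {1..M}" using \<open>M \<ge> 1\<close> by simp
  then have "interior X \<noteq> {}" using xX by blast
  note perf = is_interval_at_within_ne_bot[OF \<open>is_interval X\<close> this]
  have xi: "x i \<in> interior X" "x i \<in> X" if "i \<in> {1..M}" for i
    using xX that interior_subset[of X] by blast+
  \<comment> \<open>Even indices represent the value constraints, odd ones the derivative
    constraints; \<open>c\<close> holds the prescribed values 1 and 0.\<close>
  define e where "e = (\<lambda>j. nderiv X (j mod 2) \<phi> (x (j div 2 + 1)))"
  define c :: "nat \<Rightarrow> real" where "c = (\<lambda>j. if even j then 1 else 0)"
  have e_even: "e (2*i - 2) = \<phi> (x i)" and e_odd: "e (2*i - 1) = nderiv X 1 \<phi> (x i)"
    if "i \<in> {1..M}" for i
  proof -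
    obtain k where "i = Suc k" using \<open>i \<in> {1..M}\<close> by (cases i) auto
    then have "2*i - 2 = 2*k" "2*i - 1 = Suc (2*k)" by simp_all
    then show "e (2*i - 2) = \<phi> (x i)" "e (2*i - 1) = nderiv X 1 \<phi> (x i)"
      unfolding e_def using \<open>i = Suc k\<close> by simp_all
  qed
  have idx: "j div 2 + 1 \<in> {1..M}" if "j < 2*M" for j using that by auto
  have "Gamma_op X \<phi> M x b = (\<Sum>j<2*M. vec_index b j *\<^sub>R e j)" for b
    unfolding Gamma_op_def sum_lessThan_double 
    by (rule sum.cong[OF refl]) (simp only: e_even e_odd)
  then have indep: "independent_family (2*M) e"
    by (rule full_rank_imp_independent_family[OF rank])
  define p where "p = min_norm_element {p. \<forall>j<2*M. inner (e j) p = c j}"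
  define g where "g = Determinant.det (gram_mat (2*M) e)"
  have g: "g > 0" unfolding g_def by (rule gram_mat_det_pos[OF indep])
  have p: "inner (e j) p = c j" if "j < 2*M" for j
    unfolding p_def by (rule inner_min_norm_element[OF indep that])
  note det = det_bordered_gram_mat[OF indep, where c = c, folded p_def g_def]
  define \<eta> where "\<eta> = eta_V X \<phi> M x"
  have "{p. \<forall>i\<in>{1..M}. Phi_adj \<phi> p (x i) = 1 \<and> nderiv X 1 (Phi_adj \<phi> p) (x i) = 0} =
      {p. \<forall>j<2*M. inner (e j) p = c j}"
    unfolding all_lessThan_double_iff Phi_adj_def
    using nderiv_inner_left[OF ck perf, of 1] xi
    by (auto simp: e_even e_odd c_def simp del: One_nat_def nderiv.simps)
  then have \<eta>: "\<eta> = (\<lambda>t. inner (\<phi> t) p)"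
    by (simp add: p_def \<eta>_def eta_V_def p_V_def Phi_adj_def)
  have u0: "u_fun X \<phi> x 0 = (\<lambda>_. 1)" by (auto simp: u_fun_def)
  have uS: "u_fun X \<phi> x (Suc j) = (\<lambda>t. inner (\<phi> t) (e j))" if "j < 2*M" for j
  proof
    fix t
    \<comment> \<open>Column 0 is the constant 1, so \<open>e j\<close> sits in column
      \<open>Suc j\<close> and the parities are swapped. The rows below are shifted
      likewise.\<close>
    have "(Suc j + 1) div 2 = j div 2 + 1" "(if odd (Suc j) then 0 else 1) = j mod 2"
      by (auto simp: odd_iff_mod_2_eq_one)
    then show "u_fun X \<phi> x (Suc j) t = inner (\<phi> t) (e j)"
      unfolding u_fun_def e_def
      using d2_Corr_eq[OF ck perf _ xi(2)[OF idx[OF that]], of "j mod 2" t]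
      by (simp del: nderiv.simps)
  qed
  have det_V: "det_V X \<phi> M x t = (1 - \<eta> t) * g" for t
  proof -
    let ?A = "\<lambda>(r, j). if r = 0 then u_fun X \<phi> x j t
      else nderiv X (if odd r then 0 else 1) (u_fun X \<phi> x j) (x ((r + 1) div 2))"
    have row: "?A (Suc r, j) = nderiv X (r mod 2) (u_fun X \<phi> x j) (x (r div 2 + 1))" for r j
    proof -
      have "(Suc r + 1) div 2 = r div 2 + 1" "(if odd (Suc r) then 0 else 1) = r mod 2"
        by (auto simp: odd_iff_mod_2_eq_one)
      then show ?thesis by (simp del: nderiv.simps)
    qed
    have "Determinant.det (Matrix.mat (Suc (2*M)) (Suc (2*M)) ?A) =
        (?A (0, 0) - inner (\<phi> t) p) * g"
    proof (rule det)
      fix r assume r: "r < 2*M"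
      show "?A (Suc r, 0) = c r"
        unfolding row u0 using nderiv_const[OF perf xi(2)[OF idx[OF r]], of "r mod 2" "1 :: real"]
        by (simp add: c_def even_iff_mod_2_eq_zero)
      show "?A (Suc r, Suc j) = inner (e r) (e j)" if "j < 2*M" for j
        unfolding row uS[OF that]
        by (subst nderiv_inner_left[OF ck perf]) (use xi(2)[OF idx[OF r]] in \<open>auto simp: e_def\<close>)
    qed (simp add: uS)
    then show ?thesis by (simp add: det_V_def u0 \<eta>)
  qed
  have \<eta>_C: "\<eta> \<in> C_k 2 X"
    unfolding \<eta> by (rule C_k_bounded_linear[OF bounded_linear_inner_left ck perf])
  have \<eta>_x: "\<eta> (x i) = 1" "nderiv X 1 \<eta> (x i) = 0" if i: "i \<in> {1..M}" for i
  proof -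
    have "inner (e (2*i - 2)) p = 1" "inner (e (2*i - 1)) p = 0"
      using p[of "2*i - 2"] p[of "2*i - 1"] i by (auto simp: c_def)
    then show "\<eta> (x i) = 1" "nderiv X 1 \<eta> (x i) = 0"
      unfolding \<eta> e_even[OF i] e_odd[OF i]
      using nderiv_inner_left[OF ck perf, of 1 "x i"] xi(2)[OF i] by (auto simp del: nderiv.simps)
  qed
  have off: "D_V X \<phi> M x t > 0 \<longleftrightarrow> \<eta> t < 1" if "t \<notin> x ` {1..M}" for t
  proof -
    have "(\<Prod>i=1..M. (t - x i)\<^sup>2) > 0"
      using that by (intro prod_pos) auto
    then show ?thesis
      using that g by (simp add: D_V_def det_V zero_less_mult_iff zero_less_divide_iff)
  qed
  have on: "D_V X \<phi> M x (x i) > 0 \<longleftrightarrow> nderiv X 2 \<eta> (x i) < 0" if i: "i \<in> {1..M}" for i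
  proof -
    \<comment> \<open>Separates the only factor of the denominator that vanishes at
      \<open>x i\<close>.\<close>
    define Q where "Q = (\<lambda>s. \<Prod>j\<in>{1..M} - {i}. (s - x j)\<^sup>2)"
    have "x i \<noteq> x j" if "j \<in> {1..M} - {i}" for j
      using that i strict_mono_on_imp_inj_on[OF mono] by (auto dest: inj_onD)
    then have Q: "Q (x i) > 0" unfolding Q_def by (intro prod_pos) simp
    have "(Q \<longlongrightarrow> Q (x i)) (at (x i) within X)"
      unfolding Q_def by (intro tendsto_intros)
    moreover have "((\<lambda>t. (\<eta> t - \<eta> (x i)) / (t - x i)\<^sup>2) \<longlongrightarrow> nderiv X 2 \<eta> (x i) / fact 2)
        (at (x i) within X)"
      by (rule taylor_quotient_tendsto[OF \<eta>_C _ xi(1)[OF i]])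
        (use \<eta>_x(2)[OF i] in \<open>auto simp: numeral_2_eq_2 simp del: nderiv.simps\<close>)
    ultimately have "((\<lambda>t. - (2 * g) * ((\<eta> t - \<eta> (x i)) / (t - x i)\<^sup>2) / Q t) \<longlongrightarrow>
        - (2 * g) * (nderiv X 2 \<eta> (x i) / fact 2) / Q (x i)) (at (x i) within X)"
      using Q by (intro tendsto_divide[OF tendsto_mult[OF tendsto_const]]) simp_all
    \<comment> \<open>Since \<open>\<eta> (x i) = 1\<close>, the factor \<open>1 - \<eta> t\<close>
      is minus the Taylor numerator. The identity holds for every \<open>t\<close>: where a
      denominator vanishes, both sides are 0, as division by zero gives 0.\<close>
    moreover have "- (2 * g) * ((\<eta> t - \<eta> (x i)) / (t - x i)\<^sup>2) / Q t =
        2 / (\<Prod>j=1..M. (t - x j)\<^sup>2) * det_V X \<phi> M x t" for t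
    proof -
      have "(\<Prod>j=1..M. (t - x j)\<^sup>2) = (t - x i)\<^sup>2 * Q t"
        unfolding Q_def using i by (intro prod.remove) auto
      then show ?thesis
        by (simp add: det_V \<eta>_x(1)[OF i] field_simps)
    qed
    ultimately have "((\<lambda>t. 2 / (\<Prod>j=1..M. (t - x j)\<^sup>2) * det_V X \<phi> M x t) \<longlongrightarrow>
        - (2 * g) * (nderiv X 2 \<eta> (x i) / fact 2) / Q (x i)) (at (x i) within X)"
      by (simp only:)
    from tendsto_Lim[OF perf[OF xi(2)[OF i]] this]
    have "D_V X \<phi> M x (x i) = - (2 * g) * (nderiv X 2 \<eta> (x i) / fact 2) / Q (x i)"
      unfolding D_V_def Let_def using i by simp
    also have "\<dots> = (g / Q (x i)) * (- nderiv X 2 \<eta> (x i))"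
      by (simp add: fact_2 del: nderiv.simps)
    finally show ?thesis
      using g Q by (simp add: mult_less_0_iff divide_less_0_iff del: nderiv.simps)
  qed
  have "(\<forall>t\<in>X. D_V X \<phi> M x t > 0) \<longleftrightarrow>
      (\<forall>t\<in>X - x ` {1..M}. D_V X \<phi> M x t > 0) \<and> (\<forall>i\<in>{1..M}. D_V X \<phi> M x (x i) > 0)"
    using xi(2) by blast
  then show ?thesis unfolding \<eta>_def[symmetric] using off on by blast
qed

lemma D_W_pos_iff:
  assumes "is_interval X" and x0: "x\<^sub>0 \<in> interior X" and "M \<ge> 1"
    and ck: "\<phi> \<in> C_k (2*M) X" and rank: "full_rank (2*M) (F_op X \<phi> M x\<^sub>0)"
  shows "(\<forall>t\<in>X. D_W X \<phi> M x\<^sub>0 t > 0) \<longleftrightarrow>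
    nderiv X (2*M) (eta_W X \<phi> M x\<^sub>0) x\<^sub>0 < 0 \<and> (\<forall>t\<in>X - {x\<^sub>0}. eta_W X \<phi> M x\<^sub>0 t < 1)"
proof -
  have "interior X \<noteq> {}" using x0 by auto
  note perf = is_interval_at_within_ne_bot[OF \<open>is_interval X\<close> this]
  have x0X: "x\<^sub>0 \<in> X" using x0 interior_subset by auto
  define e where "e = (\<lambda>j. nderiv X j \<phi> x\<^sub>0)"
  \<comment> \<open>Here all constraints sit at one point, and \<open>j\<close> is the order of the
    derivative.\<close>
  define c :: "nat \<Rightarrow> real" where "c = (\<lambda>j. if j = 0 then 1 else 0)"
  have indep: "independent_family (2*M) e"
    by (rule full_rank_imp_independent_family[OF rank]) (simp add: F_op_def e_def)
  define p where "p = min_norm_element {p. \<forall>j<2*M. inner (e j) p = c j}"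
  define g where "g = Determinant.det (gram_mat (2*M) e)"
  have g: "g > 0" unfolding g_def by (rule gram_mat_det_pos[OF indep])
  have p: "inner (e j) p = c j" if "j < 2*M" for j
    unfolding p_def by (rule inner_min_norm_element[OF indep that])
  note det = det_bordered_gram_mat[OF indep, where c = c, folded p_def g_def]
  define \<eta> where "\<eta> = eta_W X \<phi> M x\<^sub>0"
  have "(Phi_adj \<phi> q x\<^sub>0 = 1 \<and> (\<forall>k\<in>{1..2*M - 1}. nderiv X k (Phi_adj \<phi> q) x\<^sub>0 = 0)) \<longleftrightarrow>
      (\<forall>j<2*M. inner (e j) q = c j)" for q
  proof -
    have eq: "inner (e k) q = nderiv X k (Phi_adj \<phi> q) x\<^sub>0" if "k < 2*M" for k
      using nderiv_inner_left[OF ck perf, of k x\<^sub>0 q] x0X that by (simp add: e_def Phi_adj_def)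
    have "(\<forall>j<2*M. inner (e j) q = c j) \<longleftrightarrow> (\<forall>j<2*M. nderiv X j (Phi_adj \<phi> q) x\<^sub>0 = c j)"
      using eq by auto
    also have "\<dots> \<longleftrightarrow> nderiv X 0 (Phi_adj \<phi> q) x\<^sub>0 = c 0 \<and>
        (\<forall>j\<in>{1..2*M - 1}. nderiv X j (Phi_adj \<phi> q) x\<^sub>0 = c j)"
    proof -
      \<comment> \<open>Order 0 is stated separately in \<open>p_W\<close>; \<open>M \<ge> 1\<close>
        ensures that it belongs to the range.\<close>
      have "{..<2*M} = insert 0 {1..2*M - 1}" using \<open>M \<ge> 1\<close> by auto
      then have "(\<forall>j<2*M. P j) \<longleftrightarrow> P 0 \<and> (\<forall>j\<in>{1..2*M - 1}. P j)" for P :: "nat \<Rightarrow> bool"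
        unfolding lessThan_iff[symmetric] Ball_def[symmetric] by simp
      then show ?thesis .
    qed
    finally show ?thesis by (auto simp: c_def simp del: nderiv.simps(2))
  qed
  then have \<eta>: "\<eta> = (\<lambda>t. inner (\<phi> t) p)"
    by (simp add: p_def \<eta>_def eta_W_def p_W_def Phi_adj_def)
  have v0: "v_fun X \<phi> x\<^sub>0 0 = (\<lambda>_. 1)" by (auto simp: v_fun_def)
  have vS: "v_fun X \<phi> x\<^sub>0 (Suc j) = (\<lambda>t. inner (\<phi> t) (e j))" if "j < 2*M" for j
    using d2_Corr_eq[OF ck perf, of j x\<^sub>0] x0X that by (auto simp: v_fun_def e_def)
  have det_W: "det_W X \<phi> M x\<^sub>0 t = (1 - \<eta> t) * g" for t
  proof -
    let ?A = "\<lambda>(r, j). if r = 0 then v_fun X \<phi> x\<^sub>0 j t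
      else nderiv X (r - 1) (v_fun X \<phi> x\<^sub>0 j) x\<^sub>0"
    have "Determinant.det (Matrix.mat (Suc (2*M)) (Suc (2*M)) ?A) =
        (?A (0, 0) - inner (\<phi> t) p) * g"
    proof (rule det)
      fix r assume r: "r < 2*M"
      show "?A (Suc r, 0) = c r"
        using nderiv_const[OF perf x0X, of r "1 :: real"] by (simp add: v0 c_def)
      show "?A (Suc r, Suc j) = inner (e r) (e j)" if "j < 2*M" for j
        using nderiv_inner_left[OF ck perf, of r x\<^sub>0 "e j"] x0X r that by (simp add: vS e_def)
    qed (simp add: vS)
    then show ?thesis by (simp add: det_W_def v0 \<eta>)
  qed
  have \<eta>_C: "\<eta> \<in> C_k (2*M) X"
    unfolding \<eta> by (rule C_k_bounded_linear[OF bounded_linear_inner_left ck perf])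
  have \<eta>_k: "nderiv X k \<eta> x\<^sub>0 = c k" if "k < 2*M" for k
    using nderiv_inner_left[OF ck perf, of k x\<^sub>0 p] x0X p[OF that] that by (simp add: \<eta> e_def)
  then have \<eta>_x0: "\<eta> x\<^sub>0 = 1" using \<eta>_k[of 0] \<open>M \<ge> 1\<close> by (simp add: c_def)
  have off: "D_W X \<phi> M x\<^sub>0 t > 0 \<longleftrightarrow> \<eta> t < 1" if "t \<noteq> x\<^sub>0" for t
  proof -
    have "(t - x\<^sub>0) ^ (2*M) > 0"
      \<comment> \<open>The even power is read as the power \<open>M\<close> of a positive
        square.\<close>
      unfolding power_mult by (rule zero_less_power) (use that in simp)
    then show ?thesis
      using that g by (simp add: D_W_def det_W zero_less_mult_iff zero_less_divide_iff)
  qed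
  have on: "D_W X \<phi> M x\<^sub>0 x\<^sub>0 > 0 \<longleftrightarrow> nderiv X (2*M) \<eta> x\<^sub>0 < 0"
  proof -
    have "((\<lambda>t. (\<eta> t - \<eta> x\<^sub>0) / (t - x\<^sub>0) ^ (2*M)) \<longlongrightarrow> nderiv X (2*M) \<eta> x\<^sub>0 / fact (2*M))
        (at x\<^sub>0 within X)"
      by (rule taylor_quotient_tendsto[OF \<eta>_C _ x0]) (use \<eta>_k \<open>M \<ge> 1\<close> in \<open>auto simp: c_def\<close>)
    \<comment> \<open>The normalising factor of \<open>D_W\<close> cancels the Taylor denominator,
      leaving \<open>- g\<close> times the derivative of order \<open>2*M\<close>.\<close>
    then have "((\<lambda>t. - (fact (2*M) * g) * ((\<eta> t - \<eta> x\<^sub>0) / (t - x\<^sub>0) ^ (2*M))) \<longlongrightarrow>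
        - (fact (2*M) * g) * (nderiv X (2*M) \<eta> x\<^sub>0 / fact (2*M))) (at x\<^sub>0 within X)"
      by (intro tendsto_mult tendsto_const)
    moreover have "- (fact (2*M) * g) * ((\<eta> t - \<eta> x\<^sub>0) / (t - x\<^sub>0) ^ (2*M)) =
        fact (2*M) / (t - x\<^sub>0) ^ (2*M) * det_W X \<phi> M x\<^sub>0 t" for t
      by (simp add: det_W \<eta>_x0 field_simps)
    ultimately have "((\<lambda>t. fact (2*M) / (t - x\<^sub>0) ^ (2*M) * det_W X \<phi> M x\<^sub>0 t) \<longlongrightarrow>
        - (fact (2*M) * g) * (nderiv X (2*M) \<eta> x\<^sub>0 / fact (2*M))) (at x\<^sub>0 within X)"
      by (simp only:)
    from tendsto_Lim[OF perf[OF x0X] this]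
    have "D_W X \<phi> M x\<^sub>0 x\<^sub>0 = g * (- nderiv X (2*M) \<eta> x\<^sub>0)"
      unfolding D_W_def Let_def by simp
    then show ?thesis
      using g by (simp add: mult_less_0_iff)
  qed
  have "(\<forall>t\<in>X. D_W X \<phi> M x\<^sub>0 t > 0) \<longleftrightarrow>
      D_W X \<phi> M x\<^sub>0 x\<^sub>0 > 0 \<and> (\<forall>t\<in>X - {x\<^sub>0}. D_W X \<phi> M x\<^sub>0 t > 0)"
    using x0X by blast
  then show ?thesis unfolding \<eta>_def[symmetric] on using off by auto
qed

theorem theorem3:
  fixes M :: nat and X :: "real set" and x a :: "nat \<Rightarrow> real" and x\<^sub>0 :: real
    and \<phi> :: "real \<Rightarrow> 'h::{real_inner, complete_space, second_countable_topology}"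
  assumes "M \<ge> 1"
    and "is_interval X"
    and "strict_mono_on {1..M} x"
    and "x ` {1..M} \<subseteq> interior X"
    and "x\<^sub>0 \<in> interior X"
  shows "(\<phi> \<in> kernel_class 2 X \<and> (\<forall>i\<in>{1..M}. 0 < a i) \<and> full_rank (2*M) (Gamma_op X \<phi> M x)
            \<longrightarrow> (NDSC X \<phi> (spike_measure X M a x) \<longleftrightarrow> (\<forall>t\<in>X. D_V X \<phi> M x t > 0)))
       \<and> (\<phi> \<in> kernel_class (2*M) X \<and> full_rank (2*M) (F_op X \<phi> M x\<^sub>0)
            \<longrightarrow> (non_degenerate X \<phi> M x\<^sub>0 \<longleftrightarrow> (\<forall>t\<in>X. D_W X \<phi> M x\<^sub>0 t > 0)))"
proof (intro conjI impI)
  assume *: "\<phi> \<in> kernel_class 2 X \<and> (\<forall>i\<in>{1..M}. 0 < a i) \<and>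
    full_rank (2*M) (Gamma_op X \<phi> M x)"
  then have "\<phi> \<in> C_k 2 X" by (simp add: kernel_class_def)
  then show "NDSC X \<phi> (spike_measure X M a x) \<longleftrightarrow> (\<forall>t\<in>X. D_V X \<phi> M x t > 0)"
    using NDSC_spike_measure[of M x X a \<phi>] D_V_pos_iff[of X M x \<phi>] assms * by simp
next
  assume *: "\<phi> \<in> kernel_class (2*M) X \<and> full_rank (2*M) (F_op X \<phi> M x\<^sub>0)"
  then have "\<phi> \<in> C_k (2*M) X" by (simp add: kernel_class_def)
  \<comment> \<open>The regularity and rank conjuncts of \<open>non_degenerate\<close> are assumed
    here, so the two conditions on \<open>eta_W\<close> remain.\<close>
  then show "non_degenerate X \<phi> M x\<^sub>0 \<longleftrightarrow> (\<forall>t\<in>X. D_W X \<phi> M x\<^sub>0 t > 0)"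
    using D_W_pos_iff[of X x\<^sub>0 M \<phi>] assms * by (simp add: non_degenerate_def)
qed

end
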